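(* Let $\mathcal{N}=\{d^{-1}|\phi_j\rangle\langle\phi_j|\}_{j=1}^{d^2}$ be a SIC-POVM in a $d$-dimensional complex Hilbert space $\mathcal{H}$. For $\alpha\in[2,\infty)$ and each density matrix $\rho$ on $\mathcal{H}$, the Rényi $\alpha$-entropy satisfies the state-dependent bound $$R_\alpha(\mathcal{N}|\rho)\;\ge\;\frac{\alpha}{2(\alpha-1)}\,\ln\!\left(\frac{d(d+1)}{\mathrm{tr}(\rho^2)+1}\right).$$
   Context: A density matrix on $\mathcal{H}$ is a positive semidefinite operator of trace $1$. A SIC-POVM (symmetric informationally complete POVM) in $d$-dimensional $\mathcal{H}$ is a set of $d^2$ operators $d^{-1}|\phi_j\rangle\langle\phi_j|$, $j=1,\ldots,d^2$, with unit vectors $|\phi_j\rangle$ satisfying $|\langle\phi_j|\phi_k\rangle|^2=\frac{1}{d+1}$ for all $j\ne k$ and the completeness relation $\frac1d\sum_{j=1}^{d^2}|\phi_j\rangle\langle\phi_j|=\mathbf{1}$ (identity operator). For a probability distribution $p=\{p_j\}$ and $\alpha>0$, $\alpha\ne 1$, the Rényi $\alpha$-entropy is $R_\alpha(p)=\frac{1}{1-\alpha}\ln\bigl(\sum_j p_j^\alpha\bigr)$. $R_\alpha(\mathcal{N}|\rho)$ denotes $R_\alpha$ of the distribution $p_j(\mathcal{N}|\rho)=d^{-1}\langle\phi_j|\rho|\phi_j\rangle$, $j=1,\ldots,d^2$. *)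

theory Defs
  imports "HOL-Analysis.Analysis"
begin

text \<open>The \<open>d\<close>-dimensional complex Hilbert space is \<open>complex ^ 'n\<close> with \<open>d = CARD('n)\<close>, and operators
  on it are square matrices. The library's inner product on \<open>complex ^ 'n\<close> is the real-valued one,
  so the sesquilinear one is defined here (linear in the second argument). It induces the library norm.\<close>

definition cinner :: "complex ^ 'n \<Rightarrow> complex ^ 'n \<Rightarrow> complex"
  where "cinner x y = (\<Sum>i\<in>UNIV. cnj (x $ i) * y $ i)"

text \<open>The rank-one operator \<open>|x\<rangle>\<langle>x|\<close>.\<close>

definition ketbra :: "complex ^ 'n \<Rightarrow> complex ^ 'n ^ 'n"
  where "ketbra x = (\<chi> i j. x $ i * cnj (x $ j))"

definition hermitian :: "complex ^ 'n ^ 'n \<Rightarrow> bool"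
  where "hermitian A \<longleftrightarrow> (\<forall>i j. A $ i $ j = cnj (A $ j $ i))"

text \<open>The quadratic form of a Hermitian operator is real, so taking \<open>Re\<close> loses nothing.\<close>

definition positive_semidefinite :: "complex ^ 'n ^ 'n \<Rightarrow> bool"
  where "positive_semidefinite A \<longleftrightarrow> hermitian A \<and> (\<forall>v. 0 \<le> Re (cinner v (A *v v)))"

definition density_matrix :: "complex ^ 'n ^ 'n \<Rightarrow> bool"
  where "density_matrix \<rho> \<longleftrightarrow> positive_semidefinite \<rho> \<and> trace \<rho> = 1"

text \<open>A SIC-POVM \<open>{d\<^sup>-\<^sup>1 |\<phi>\<^sub>j\<rangle>\<langle>\<phi>\<^sub>j|}\<close> is given by its vectors \<open>\<phi> j\<close>, \<open>j = 1, \<dots>, d\<^sup>2\<close>;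
  values of \<open>\<phi>\<close> at other indices are irrelevant.\<close>

definition sic_povm :: "(nat \<Rightarrow> complex ^ 'n) \<Rightarrow> bool"
  where "sic_povm \<phi> \<longleftrightarrow>
    (\<forall>j\<in>{1..CARD('n)\<^sup>2}. norm (\<phi> j) = 1) \<and>
    (\<forall>j\<in>{1..CARD('n)\<^sup>2}. \<forall>k\<in>{1..CARD('n)\<^sup>2}. j \<noteq> k \<longrightarrow>
       (cmod (cinner (\<phi> j) (\<phi> k)))\<^sup>2 = 1 / (real CARD('n) + 1)) \<and>
    (1 / real CARD('n)) *\<^sub>R (\<Sum>j\<in>{1..CARD('n)\<^sup>2}. ketbra (\<phi> j)) = mat 1"

text \<open>The outcome probability \<open>d\<^sup>-\<^sup>1 \<langle>\<phi>\<^sub>j|\<rho>|\<phi>\<^sub>j\<rangle>\<close>; the form is real-valued when \<open>\<rho>\<close> is Hermitian.\<close>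

definition outcome_prob :: "(nat \<Rightarrow> complex ^ 'n) \<Rightarrow> complex ^ 'n ^ 'n \<Rightarrow> nat \<Rightarrow> real"
  where "outcome_prob \<phi> \<rho> j = Re (cinner (\<phi> j) (\<rho> *v \<phi> j)) / real CARD('n)"

text \<open>Meaningful for \<open>\<alpha> > 0\<close>, \<open>\<alpha> \<noteq> 1\<close> and a probability distribution \<open>p\<close> on the finite set \<open>J\<close>.\<close>

definition renyi_entropy :: "real \<Rightarrow> 'a set \<Rightarrow> ('a \<Rightarrow> real) \<Rightarrow> real"
  where "renyi_entropy \<alpha> J p = 1 / (1 - \<alpha>) * ln (\<Sum>j\<in>J. p j powr \<alpha>)"

definition sic_renyi_entropy :: "real \<Rightarrow> (nat \<Rightarrow> complex ^ 'n) \<Rightarrow> complex ^ 'n ^ 'n \<Rightarrow> real"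
  where "sic_renyi_entropy \<alpha> \<phi> \<rho> = renyi_entropy \<alpha> {1..CARD('n)\<^sup>2} (outcome_prob \<phi> \<rho>)"

end

theory Submission
  imports Defs
begin

text \<open>Matrices form a real inner product space with \<open>A \<bullet> B = Re (tr (A\<^sup>\<dagger> B))\<close>. Write \<open>P\<^sub>j\<close> for the
  projectors and \<open>d\<close> for the dimension. The operator that linear inversion of the SIC statistics
  reconstructs is \<open>\<Sum>\<^sub>j ((d+1) p\<^sub>j - 1/d) P\<^sub>j\<close>, and its squared distance from \<open>\<rho>\<close> is
  \<open>tr \<rho>\<^sup>2 + 1 - d(d+1) \<Sum>\<^sub>j p\<^sub>j\<^sup>2\<close>. Hence the index of coincidence \<open>\<Sum>\<^sub>j p\<^sub>j\<^sup>2\<close> is at most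
  \<open>(tr \<rho>\<^sup>2 + 1) / (d(d+1))\<close>. The entropy bound follows because the
  \<open>\<ell>\<^sup>\<alpha>\<close> norm is at most the \<open>\<ell>\<^sup>2\<close> norm for \<open>\<alpha> \<ge> 2\<close>.\<close>

lemma inner_matrix_eq_Re_sum:
  fixes A B :: "complex ^ 'n ^ 'm"
  shows "A \<bullet> B = Re (\<Sum>i\<in>UNIV. \<Sum>j\<in>UNIV. cnj (A $ i $ j) * B $ i $ j)"
  by (simp add: inner_vec_def inner_complex_def)

lemma inner_ketbra_ketbra:
  "ketbra x \<bullet> ketbra y = (cmod (cinner x y))\<^sup>2"
proof -
  have "complex_of_real ((cmod (cinner x y))\<^sup>2) = cinner x y * cnj (cinner x y)"
    by (rule complex_norm_square)
  also have "\<dots> = (\<Sum>i\<in>UNIV. \<Sum>j\<in>UNIV. cnj (ketbra x $ i $ j) * ketbra y $ i $ j)"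
    unfolding cinner_def cnj_sum sum_product by (simp add: ketbra_def mult_ac)
  finally have "Re (complex_of_real ((cmod (cinner x y))\<^sup>2)) = ketbra x \<bullet> ketbra y"
    by (simp only: inner_matrix_eq_Re_sum)
  then show ?thesis
    by simp
qed

text \<open>Makes \<open>outcome_prob\<close> linear in the projector: up to the factor
  \<open>1 / d\<close> it is the inner product of \<open>\<rho>\<close> with
  \<open>ketbra (\<phi> j)\<close>.\<close>

lemma inner_ketbra_right:
  "A \<bullet> ketbra x = Re (cinner x (A *v x))"
proof -
  have "(\<Sum>i\<in>UNIV. \<Sum>j\<in>UNIV. cnj (A $ i $ j) * ketbra x $ i $ j) = cnj (cinner x (A *v x))"
    by (simp add: cinner_def ketbra_def matrix_vector_mult_def sum_distrib_left mult_ac)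
  then show ?thesis
    by (simp only: inner_matrix_eq_Re_sum cnj.sel)
qed

lemma inner_mat_one_right:
  fixes A :: "complex ^ 'n ^ 'n"
  shows "A \<bullet> mat 1 = Re (trace A)"
  by (simp add: inner_matrix_eq_Re_sum mat_def trace_def if_distrib cong: if_cong)

text \<open>Conjugating an entry of a Hermitian matrix transposes it, so the purity of a state is
  its squared norm.\<close>

lemma inner_self_hermitian:
  assumes "hermitian A"
  shows "A \<bullet> A = Re (trace (A ** A))"
proof -
  have "cnj (A $ i $ j) * A $ i $ j = A $ i $ j * A $ j $ i" for i j
    using assms unfolding hermitian_def by (metis mult.commute)
  then show ?thesis
    by (simp only: inner_matrix_eq_Re_sum trace_def matrix_matrix_mult_def vec_lambda_beta)
qed

lemma cinner_self: "cinner x x = complex_of_real ((norm x)\<^sup>2)"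
proof -
  have "(norm x)\<^sup>2 = (\<Sum>i\<in>UNIV. (cmod (x $ i))\<^sup>2)"
    by (simp add: norm_vec_def L2_set_def sum_nonneg)
  then show ?thesis
    by (simp only: cinner_def of_real_sum complex_norm_square mult.commute)
qed

text \<open>Each term is at most the total \<open>S\<close>, so one factor \<open>q j\<close> can be
  kept and the remaining power \<open>\<beta> - 1 \<ge> 0\<close> bounded by that of
  \<open>S\<close>.\<close>

lemma sum_powr_le_powr_sum:
  fixes q :: "'a \<Rightarrow> real"
  assumes "finite J" "\<And>j. j \<in> J \<Longrightarrow> 0 \<le> q j" "1 \<le> \<beta>"
  shows "(\<Sum>j\<in>J. q j powr \<beta>) \<le> (\<Sum>j\<in>J. q j) powr \<beta>"
proof -
  define S where "S = (\<Sum>j\<in>J. q j)"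
  have S: "0 \<le> S"
    unfolding S_def using assms by (simp add: sum_nonneg)
  have split: "x powr \<beta> = x * x powr (\<beta> - 1)" if "0 \<le> x" for x :: real
    \<comment> \<open>\<open>0 powr a\<close> is \<open>0\<close> for every \<open>a\<close>,
      including \<open>a = 0\<close>, so the splitting survives at \<open>x = 0\<close> even when
      \<open>\<beta> = 1\<close>.\<close>
    using that by (cases "x = 0") (simp_all add: powr_diff)
  have "q j powr \<beta> \<le> q j * S powr (\<beta> - 1)" if "j \<in> J" for j
  proof -
    have "q j \<le> S"
      unfolding S_def using assms that by (intro member_le_sum) auto
    then show ?thesis
      using assms that by (simp add: split mult_left_mono powr_mono2)
  qed
  then have "(\<Sum>j\<in>J. q j powr \<beta>) \<le> (\<Sum>j\<in>J. q j * S powr (\<beta> - 1))"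
    by (rule sum_mono)
  also have "\<dots> = S powr \<beta>"
    using S by (simp add: split sum_distrib_right[symmetric] flip: S_def)
  finally show ?thesis
    by (simp add: S_def)
qed

lemma outcome_prob_nonneg:
  "density_matrix \<rho> \<Longrightarrow> 0 \<le> outcome_prob \<phi> \<rho> j"
  by (simp add: outcome_prob_def density_matrix_def positive_semidefinite_def)

text \<open>By completeness the total is the inner product of \<open>\<rho>\<close> with the
  identity, which is its trace.\<close>

lemma sum_outcome_prob:
  fixes \<phi> :: "nat \<Rightarrow> complex ^ 'n"
  assumes "sic_povm \<phi>" "density_matrix \<rho>"
  shows "(\<Sum>j\<in>{1..CARD('n)\<^sup>2}. outcome_prob \<phi> \<rho> j) = 1"
proof -
  have "(\<Sum>j\<in>{1..CARD('n)\<^sup>2}. outcome_prob \<phi> \<rho> j)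
      = \<rho> \<bullet> ((1 / real CARD('n)) *\<^sub>R (\<Sum>j\<in>{1..CARD('n)\<^sup>2}. ketbra (\<phi> j)))"
    by (simp add: inner_sum_right inner_ketbra_right outcome_prob_def flip: sum_divide_distrib)
  also have "\<dots> = \<rho> \<bullet> mat 1"
    using assms(1) by (simp only: sic_povm_def)
  finally show ?thesis
    using assms(2) by (simp add: density_matrix_def inner_mat_one_right)
qed

text \<open>The Gram matrix of the projectors is a constant matrix plus a multiple of the identity.
  In this form a double sum over it reduces to a squared sum and a sum of squares.\<close>

lemma inner_ketbra_sic_povm:
  fixes \<phi> :: "nat \<Rightarrow> complex ^ 'n"
  assumes "sic_povm \<phi>" "j \<in> {1..CARD('n)\<^sup>2}" "k \<in> {1..CARD('n)\<^sup>2}"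
  shows "ketbra (\<phi> j) \<bullet> ketbra (\<phi> k)
    = 1 / (real CARD('n) + 1) + (if j = k then real CARD('n) / (real CARD('n) + 1) else 0)"
proof (cases "j = k")
  case True
  have "norm (\<phi> k) = 1"
    using assms by (simp add: sic_povm_def)
  then show ?thesis
    using True by (simp add: inner_ketbra_ketbra cinner_self flip: add_divide_distrib)
next
  case False
  then show ?thesis
    using assms by (simp add: inner_ketbra_ketbra sic_povm_def)
qed

lemma sum_outcome_prob_squared_le:
  fixes \<phi> :: "nat \<Rightarrow> complex ^ 'n"
  assumes "sic_povm \<phi>" "density_matrix \<rho>"
  shows "(\<Sum>j\<in>{1..CARD('n)\<^sup>2}. (outcome_prob \<phi> \<rho> j)\<^sup>2)
    \<le> (Re (trace (\<rho> ** \<rho>)) + 1) / (real CARD('n) * (real CARD('n) + 1))"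
proof -
  define d where "d = real CARD('n)"
  define J where "J = {1..CARD('n)\<^sup>2}"
  define p where "p = outcome_prob \<phi> \<rho>"
  \<comment> \<open>These coefficients make the inner product of \<open>T\<close> with each
    projector equal to \<open>d * p j\<close>, the same as for \<open>\<rho>\<close>. So
    \<open>T\<close> is the orthogonal projection of \<open>\<rho>\<close> onto the span of the
    projectors.\<close>
  define c where "c j = (d + 1) * p j - 1 / d" for j
  define Q where "Q = (\<Sum>j\<in>J. (p j)\<^sup>2)"
  define T where "T = (\<Sum>j\<in>J. c j *\<^sub>R ketbra (\<phi> j))"
  have d: "d > 0"
    by (simp add: d_def)
  have fin: "finite J" and cardJ: "real (card J) = d\<^sup>2"
    by (simp_all add: J_def d_def)
  have sum_p: "(\<Sum>j\<in>J. p j) = 1"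
    using sum_outcome_prob[OF assms] by (simp add: J_def p_def)
  have sum_c: "(\<Sum>j\<in>J. c j) = 1"
    using d by (simp add: c_def sum_subtractf sum_p cardJ power2_eq_square flip: sum_distrib_left)
  have "(\<Sum>j\<in>J. c j * p j) = (\<Sum>j\<in>J. (d + 1) * (p j)\<^sup>2 - 1 / d * p j)"
    by (simp add: c_def left_diff_distrib right_diff_distrib power2_eq_square mult_ac)
  also have "\<dots> = (d + 1) * Q - 1 / d"
    by (simp only: sum_subtractf Q_def sum_p mult_1_right flip: sum_distrib_left)
  finally have sum_cp: "(\<Sum>j\<in>J. c j * p j) = (d + 1) * Q - 1 / d" .
  have "(\<Sum>j\<in>J. (c j)\<^sup>2) = (\<Sum>j\<in>J. (d + 1) * (c j * p j) - 1 / d * c j)"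
    by (intro sum.cong refl) (simp add: c_def left_diff_distrib right_diff_distrib power2_eq_square mult_ac)
  also have "\<dots> = (d + 1) * ((d + 1) * Q - 1 / d) - 1 / d"
    by (simp only: sum_subtractf sum_c sum_cp mult_1_right flip: sum_distrib_left)
  finally have sum_cc: "(\<Sum>j\<in>J. (c j)\<^sup>2) = (d + 1) * ((d + 1) * Q - 1 / d) - 1 / d" .
  have "\<rho> \<bullet> T = (\<Sum>j\<in>J. d * (c j * p j))"
    using d by (simp add: T_def inner_sum_right inner_ketbra_right p_def outcome_prob_def d_def)
  then have rho_T: "\<rho> \<bullet> T = d * ((d + 1) * Q - 1 / d)"
    by (simp only: sum_cp flip: sum_distrib_left)
  have "T \<bullet> T = (\<Sum>j\<in>J. \<Sum>k\<in>J. c j * (c k * (ketbra (\<phi> j) \<bullet> ketbra (\<phi> k))))"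
    by (simp add: T_def inner_sum_right inner_sum_left sum_distrib_left inner_commute mult_ac)
  also have "\<dots> = (\<Sum>j\<in>J. \<Sum>k\<in>J. 1 / (d + 1) * (c j * c k)
      + (if j = k then d / (d + 1) * (c j * c k) else 0))"
    using inner_ketbra_sic_povm[OF assms(1)]
    by (intro sum.cong refl) (simp add: J_def d_def algebra_simps)
  also have "\<dots> = 1 / (d + 1) * ((\<Sum>j\<in>J. c j) * (\<Sum>k\<in>J. c k)) + d / (d + 1) * (\<Sum>j\<in>J. (c j)\<^sup>2)"
    unfolding sum_product unfolding sum_distrib_left using fin by (simp add: sum.distrib power2_eq_square)
  finally have T_T: "T \<bullet> T = 1 / (d + 1) + d / (d + 1) * (\<Sum>j\<in>J. (c j)\<^sup>2)"
    by (simp add: sum_c)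
  have T_T': "T \<bullet> T = d * (d + 1) * Q - 1"
  proof -
    have "d * (\<Sum>j\<in>J. (c j)\<^sup>2) = (d + 1) * (d * (d + 1) * Q - 1) - 1"
      unfolding sum_cc using d by (simp add: field_simps)
    moreover have "T \<bullet> T = (1 + d * (\<Sum>j\<in>J. (c j)\<^sup>2)) / (d + 1)"
      unfolding T_T by (simp only: add_divide_distrib times_divide_eq_left)
    ultimately show ?thesis
      using d by simp
  qed
  have rho_rho: "\<rho> \<bullet> \<rho> = Re (trace (\<rho> ** \<rho>))"
    using assms(2) by (simp add: inner_self_hermitian density_matrix_def positive_semidefinite_def)
  have "0 \<le> (\<rho> - T) \<bullet> (\<rho> - T)"
    by simp
  also have "\<dots> = \<rho> \<bullet> \<rho> - 2 * (\<rho> \<bullet> T) + T \<bullet> T"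
    by (simp add: inner_diff_left inner_diff_right inner_commute)
  \<comment> \<open>Both \<open>\<rho> \<bullet> T\<close> and \<open>T \<bullet> T\<close> equal
    \<open>d * (d + 1) * Q - 1\<close>, as befits a projection.\<close>
  also have "\<dots> = Re (trace (\<rho> ** \<rho>)) + 1 - d * (d + 1) * Q"
    unfolding T_T' rho_T rho_rho using d by (simp add: algebra_simps)
  finally have "Q \<le> (Re (trace (\<rho> ** \<rho>)) + 1) / (d * (d + 1))"
    using d by (subst pos_le_divide_eq) (simp_all add: mult.commute)
  then show ?thesis
    by (simp add: Q_def p_def J_def d_def)
qed

lemma renyi_entropy_ge_of_sum_squares_le:
  fixes p :: "'a \<Rightarrow> real"
  assumes "finite J" "\<And>j. j \<in> J \<Longrightarrow> 0 \<le> p j" "(\<Sum>j\<in>J. p j) = 1"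
    and "(\<Sum>j\<in>J. (p j)\<^sup>2) \<le> B" "2 \<le> \<alpha>"
  shows "renyi_entropy \<alpha> J p \<ge> \<alpha> / (2 * (\<alpha> - 1)) * ln (1 / B)"
proof -
  \<comment> \<open>One positive probability makes both power sums, and hence \<open>B\<close>,
    positive, so every logarithm below has a positive argument.\<close>
  obtain i where i: "i \<in> J" "0 < p i"
    using assms by (metis less_eq_real_def sum.neutral zero_neq_one)
  have "0 < (\<Sum>j\<in>J. (p j)\<^sup>2)"
    using assms i by (intro sum_pos2[of J i]) auto
  then have B: "0 < B"
    using assms by linarith
  have pos: "0 < (\<Sum>j\<in>J. p j powr \<alpha>)"
    using assms i by (intro sum_pos2[of J i]) auto
  \<comment> \<open>Passing to squares leaves the exponent \<open>\<alpha> / 2\<close>, which is at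
    least 1 exactly because \<open>\<alpha> \<ge> 2\<close>.\<close>
  have "(\<Sum>j\<in>J. p j powr \<alpha>) = (\<Sum>j\<in>J. (p j)\<^sup>2 powr (\<alpha> / 2))"
    using assms by (intro sum.cong refl) (simp add: powr_powr flip: powr_numeral)
  also have "\<dots> \<le> (\<Sum>j\<in>J. (p j)\<^sup>2) powr (\<alpha> / 2)"
    using assms by (intro sum_powr_le_powr_sum) auto
  also have "\<dots> \<le> B powr (\<alpha> / 2)"
    using assms by (intro powr_mono2 sum_nonneg) auto
  finally have "ln (\<Sum>j\<in>J. p j powr \<alpha>) \<le> ln (B powr (\<alpha> / 2))"
    using pos B by (subst ln_le_cancel_iff) auto
  also have "\<dots> = \<alpha> / 2 * ln B"
    using B by (simp add: ln_powr)
  \<comment> \<open>The prefactor is negative, so the upper bound on the power sum becomes a lower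
    bound on the entropy.\<close>
  finally have "1 / (1 - \<alpha>) * (\<alpha> / 2 * ln B) \<le> 1 / (1 - \<alpha>) * ln (\<Sum>j\<in>J. p j powr \<alpha>)"
    using assms by (intro mult_left_mono_neg) auto
  moreover have "1 / (1 - \<alpha>) * (\<alpha> / 2 * ln B) = \<alpha> / (2 * (\<alpha> - 1)) * ln (1 / B)"
    using B assms by (simp add: ln_div divide_simps) (simp add: algebra_simps)
  ultimately show ?thesis
    by (simp add: renyi_entropy_def)
qed

theorem proposition7:
  fixes \<phi> :: "nat \<Rightarrow> complex ^ 'n" and \<rho> :: "complex ^ 'n ^ 'n" and \<alpha> :: real
  assumes "sic_povm \<phi>" and "density_matrix \<rho>" and "2 \<le> \<alpha>"
  shows "sic_renyi_entropy \<alpha> \<phi> \<rho> \<ge>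
    \<alpha> / (2 * (\<alpha> - 1)) *
      ln (real CARD('n) * (real CARD('n) + 1) / (Re (trace (\<rho> ** \<rho>)) + 1))"
proof -
  let ?d = "real CARD('n)" and ?t = "Re (trace (\<rho> ** \<rho>))"
  have "renyi_entropy \<alpha> {1..CARD('n)\<^sup>2} (outcome_prob \<phi> \<rho>)
      \<ge> \<alpha> / (2 * (\<alpha> - 1)) * ln (1 / ((?t + 1) / (?d * (?d + 1))))"
  proof (rule renyi_entropy_ge_of_sum_squares_le)
    show "(\<Sum>j\<in>{1..CARD('n)\<^sup>2}. outcome_prob \<phi> \<rho> j) = 1"
      using assms(1,2) by (rule sum_outcome_prob)
    show "(\<Sum>j\<in>{1..CARD('n)\<^sup>2}. (outcome_prob \<phi> \<rho> j)\<^sup>2) \<le> (?t + 1) / (?d * (?d + 1))"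
      using assms(1,2) by (rule sum_outcome_prob_squared_le)
  qed (use assms in \<open>simp_all add: outcome_prob_nonneg\<close>)
  then show ?thesis
    by (simp add: sic_renyi_entropy_def)
qed

end
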